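(* Let $q$ be a prime power with $q\equiv3\pmod4$, $G=\mathrm{SL}_2(\mathbb F_q)$, and $S$ the union of the conjugacy classes in $G$ of $\begin{pmatrix}1&0\\1&1\end{pmatrix}$ and $\begin{pmatrix}1&0\\-1&1\end{pmatrix}$. Let $\sigma_q$ be the automorphism of $G$ induced by conjugation by either of the matrices $\begin{pmatrix}0&1\\1&0\end{pmatrix}$, $\begin{pmatrix}0&1\\-1&0\end{pmatrix}$ in $\mathrm{GL}_2(\mathbb F_q)$. Then the graphs $C_\Sigma(G,S)$, $C(G,S)^{\sigma_q}$ and $C_\Sigma(G,S)^{\sigma_q}$ are Ramanujan graphs.
   Context: For a group $G$, subset $S$ and automorphism $\sigma$: $C_\Sigma(G,S)$ has vertex set $G$ and an edge from $x$ to $x^{-1}s$ for each $s\in S$; $C(G,S)^\sigma$ has an edge from $x$ to $\sigma(xs)$; $C_\Sigma(G,S)^\sigma$ has an edge from $x$ to $\sigma(x^{-1}s)$. A $k$-regular undirected graph is Ramanujan if every eigenvalue $\lambda$ of its adjacency matrix with $|\lambda|\ne k$ satisfies $|\lambda|\le2\sqrt{k-1}$. *)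

theory Defs
  imports "HOL-Analysis.Analysis"
begin

definition mat2 :: "'a \<Rightarrow> 'a \<Rightarrow> 'a \<Rightarrow> 'a \<Rightarrow> 'a ^ 2 ^ 2" where
  "mat2 a b c d = (\<chi> i j. if i = 1 then (if j = 1 then a else b) else (if j = 1 then c else d))"

definition SL2 :: "('a::field ^ 2 ^ 2) set" where
  "SL2 = {A. det A = 1}"

definition conj_class_SL2 :: "'a::field ^ 2 ^ 2 \<Rightarrow> ('a ^ 2 ^ 2) set" where
  "conj_class_SL2 u = {g ** u ** matrix_inv g | g. g \<in> SL2}"

text \<open>Adjacency (edge multiplicity) of the graph on vertex set G with one edge
  from x to f x s for each s in S.\<close>
definition adj_of :: "'s set \<Rightarrow> ('v \<Rightarrow> 's \<Rightarrow> 'v) \<Rightarrow> 'v \<Rightarrow> 'v \<Rightarrow> nat" where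
  "adj_of S f x y = card {s \<in> S. f x s = y}"

definition C_Sigma_adj :: "('a::field ^ 2 ^ 2) set \<Rightarrow> 'a ^ 2 ^ 2 \<Rightarrow> 'a ^ 2 ^ 2 \<Rightarrow> nat" where
  "C_Sigma_adj S = adj_of S (\<lambda>x s. matrix_inv x ** s)"

definition C_twist_adj :: "('a::field ^ 2 ^ 2 \<Rightarrow> 'a ^ 2 ^ 2) \<Rightarrow> ('a ^ 2 ^ 2) set
    \<Rightarrow> 'a ^ 2 ^ 2 \<Rightarrow> 'a ^ 2 ^ 2 \<Rightarrow> nat" where
  "C_twist_adj \<sigma> S = adj_of S (\<lambda>x s. \<sigma> (x ** s))"

definition C_Sigma_twist_adj :: "('a::field ^ 2 ^ 2 \<Rightarrow> 'a ^ 2 ^ 2) \<Rightarrow> ('a ^ 2 ^ 2) set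
    \<Rightarrow> 'a ^ 2 ^ 2 \<Rightarrow> 'a ^ 2 ^ 2 \<Rightarrow> nat" where
  "C_Sigma_twist_adj \<sigma> S = adj_of S (\<lambda>x s. \<sigma> (matrix_inv x ** s))"

text \<open>A (multi)graph on a finite vertex set V given by its adjacency matrix A
  (edge multiplicities) is an undirected k-regular Ramanujan graph: A is symmetric,
  every row sums to k, and every (real) eigenvalue lambda of A with |lambda| /= k
  satisfies |lambda| <= 2 sqrt(k-1).  (A is real symmetric, so all eigenvalues are real.)\<close>
definition ramanujan :: "'v set \<Rightarrow> ('v \<Rightarrow> 'v \<Rightarrow> nat) \<Rightarrow> nat \<Rightarrow> bool" where
  "ramanujan V A k \<longleftrightarrow>
     finite V \<and>
     (\<forall>x\<in>V. \<forall>y\<in>V. A x y = A y x) \<and>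
     (\<forall>x\<in>V. (\<Sum>y\<in>V. A x y) = k) \<and>
     (\<forall>\<mu>::real. (\<exists>v::'v \<Rightarrow> real. (\<exists>x\<in>V. v x \<noteq> 0) \<and>
                   (\<forall>x\<in>V. (\<Sum>y\<in>V. real (A x y) * v y) = \<mu> * v x))
        \<longrightarrow> \<bar>\<mu>\<bar> \<noteq> real k \<longrightarrow> \<bar>\<mu>\<bar> \<le> 2 * sqrt (real k - 1))"

end

theory Submission
  imports Defs
begin

text \<open>Every element of the field is a square or minus a square, so \<open>S\<close> consists of all nontrivial
  unipotents. In each of the three graphs the adjacency operator is an involution of the vertex set
  composed with the operator \<open>A\<close> of the Cayley graph, and its square is \<open>A\<^sup>2\<close>; so its eigenvalues
  agree up to sign with eigenvalues of \<open>A\<close>. Let \<open>f\<close> be an eigenfunction of \<open>A\<close> for \<open>\<nu>\<close>. If the sums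
  \<open>F r\<close> of every left translate of \<open>f\<close> over the matrices with first row \<open>r\<close> vanish, then \<open>f\<close> sums
  to 0 over each coset of each of the \<open>q + 1\<close> Sylow subgroups making up \<open>S\<close>, and \<open>\<nu> = - (q + 1)\<close>.
  Otherwise some \<open>F\<close> is nonzero and satisfies
  \<open>\<nu> F r = (q - 1) F r + (\<Sum>z. F z) - (\<Sum>c. F (c r))\<close> for \<open>r \<noteq> 0\<close>; summing over all \<open>r\<close>, and then over
  the line of \<open>r\<close>, gives \<open>\<nu> = q\<^sup>2 - 1\<close>, \<open>\<nu> = 0\<close> or \<open>\<nu> = q - 1\<close>.\<close>

section \<open>Arithmetic of 2 x 2 matrices and of \<open>SL2\<close>\<close>

lemma mat2_nth [simp]:
  "mat2 a b c d $ 1 $ 1 = a" "mat2 a b c d $ 1 $ 2 = b"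
  "mat2 a b c d $ 2 $ 1 = c" "mat2 a b c d $ 2 $ 2 = d"
  by (simp_all add: mat2_def)

lemma mat2_eq_iff:
  "mat2 a b c d = mat2 a' b' c' d' \<longleftrightarrow> a = a' \<and> b = b' \<and> c = c' \<and> d = d'"
  by (auto simp: vec_eq_iff forall_2)

lemma mat2_eta: "mat2 (A $ 1 $ 1) (A $ 1 $ 2) (A $ 2 $ 1) (A $ 2 $ 2) = A"
  by (simp add: vec_eq_iff forall_2)

lemma mat2_cases: obtains a b c d where "A = mat2 a b c d"
  using mat2_eta[of A] by metis

lemma mat2_mult:
  fixes a :: "'a::semiring_1"
  shows "mat2 a b c d ** mat2 a' b' c' d' =
    mat2 (a * a' + b * c') (a * b' + b * d') (c * a' + d * c') (c * b' + d * d')"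
  by (simp add: vec_eq_iff forall_2 matrix_matrix_mult_def sum_2)

lemma mat_1_mat2: "mat 1 = mat2 1 0 0 1"
  by (simp add: vec_eq_iff forall_2 mat_def)

lemma det_mat2: "det (mat2 a b c d) = a * d - b * c"
  by (simp add: det_2)

lemma mat2_mem_SL2: "mat2 a b c d \<in> SL2 \<longleftrightarrow> a * d - b * c = 1"
  by (simp add: SL2_def det_mat2)

lemma matrix_inv_unique:
  fixes A :: "'a::field ^ 'n ^ 'n"
  assumes "A ** B = mat 1"
  shows "matrix_inv A = B"
proof -
  have "B ** A = mat 1" using assms by (simp add: matrix_left_right_inverse)
  then have "A ** matrix_inv A = mat 1"
    unfolding matrix_inv_def using assms by (rule_tac someI2[of _ B]) auto
  then have "B ** (A ** matrix_inv A) = B" by simp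
  then show ?thesis by (simp add: matrix_mul_assoc \<open>B ** A = mat 1\<close>)
qed

lemma matrix_inv_mat2:
  assumes "a * d - b * c = (1::'a::field)"
  shows "matrix_inv (mat2 a b c d) = mat2 d (- b) (- c) a"
  by (rule matrix_inv_unique) (use assms in \<open>simp add: mat2_mult mat_1_mat2 mat2_eq_iff algebra_simps\<close>)

lemma SL2_mult: "A \<in> SL2 \<Longrightarrow> B \<in> SL2 \<Longrightarrow> A ** B \<in> SL2"
  by (simp add: SL2_def det_mul)

lemma SL2_inv:
  assumes "A \<in> SL2"
  shows "matrix_inv A \<in> SL2" "A ** matrix_inv A = mat 1" "matrix_inv A ** A = mat 1"
    "matrix_inv (matrix_inv A) = A"
  using assms
  by (cases A rule: mat2_cases; simp add: mat2_mem_SL2 matrix_inv_mat2 mat2_mult mat_1_mat2 mat2_eq_iff algebra_simps)+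

lemma SL2_cancel:
  assumes "A \<in> SL2"
  shows "A ** (matrix_inv A ** B) = B" "matrix_inv A ** (A ** B) = B"
  by (simp_all add: assms SL2_inv matrix_mul_assoc)

lemma SL2_inv_mult:
  assumes "A \<in> SL2" "B \<in> SL2"
  shows "matrix_inv (A ** B) = matrix_inv B ** matrix_inv A"
proof (rule matrix_inv_unique)
  have "A ** B ** (matrix_inv B ** matrix_inv A) = A ** (B ** (matrix_inv B ** matrix_inv A))"
    by (simp add: matrix_mul_assoc)
  then show "A ** B ** (matrix_inv B ** matrix_inv A) = mat 1"
    by (simp add: assms SL2_inv SL2_cancel)
qed

section \<open>Nontrivial unipotents and the connection set\<close>

text \<open>Determinant 1 and trace 2 give the characteristic polynomial (X - 1)^2, so this
  describes the nontrivial unipotents by two polynomial equations.\<close>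

definition unip :: "('a::field ^ 2 ^ 2) set" where
  "unip = {s \<in> SL2. trace s = 2 \<and> s \<noteq> mat 1}"

lemma mat2_mem_unip:
  "mat2 a b c d \<in> unip \<longleftrightarrow>
    a * d - b * c = 1 \<and> a + d = 2 \<and> mat2 a b c d \<noteq> mat2 1 0 0 1"
  by (simp add: unip_def mat2_mem_SL2 trace_def sum_2 mat_1_mat2)

text \<open>Multiplication by \<open>z\<close> permutes the nonzero elements, so the factor z^(q -
  1) leaves their product unchanged.\<close>

lemma power_CARD_minus_1:
  fixes z :: "'a::{finite,field}"
  assumes "z \<noteq> 0"
  shows "z ^ (CARD('a) - 1) = 1"
proof -
  have "(\<Prod>y\<in>UNIV-{0}. z * y) = (\<Prod>y\<in>UNIV-{0}. y)"
    by (rule prod.reindex_bij_witness[of _ "\<lambda>y. y / z" "\<lambda>y. z * y"]) (use assms in auto)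
  then show ?thesis by (simp add: prod.distrib)
qed

text \<open>If q = 4n + 3, then 2n + 1 is half of q - 1, so z^(2n + 1) is 1 or -1 for nonzero
  \<open>z\<close>. One more factor \<open>z\<close> makes the exponent even, whence z or -z equals
  the square of z^(n + 1).\<close>

lemma square_or_neg_square:
  fixes z :: "'a::{finite,field}"
  assumes "CARD('a) mod 4 = 3"
  obtains d where "z = d\<^sup>2 \<or> z = - d\<^sup>2"
proof (cases "z = 0")
  case True
  then show ?thesis using that[of 0] by simp
next
  case False
  define n where "n = CARD('a) div 4"
  have "CARD('a) - 1 = (2 * n + 1) * 2"
    using assms unfolding n_def by presburger
  then have "(z ^ (2 * n + 1))\<^sup>2 = 1"
    using power_CARD_minus_1[OF False] by (metis power_mult)
  then have "z ^ (2 * n + 1) = 1 \<or> z ^ (2 * n + 1) = - 1"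
    by (simp add: power2_eq_1_iff)
  moreover have "z * z ^ (2 * n + 1) = (z ^ (n + 1))\<^sup>2"
    by (simp add: power_mult[symmetric] mult.commute power_add power2_eq_square algebra_simps power_mult)
  ultimately have "z = (z ^ (n + 1))\<^sup>2 \<or> z = - (z ^ (n + 1))\<^sup>2"
    by (metis add.inverse_inverse mult.right_neutral mult_minus_right)
  then show ?thesis using that by blast
qed

text \<open>The conjugate is the identity plus \<open>t\<close> times the product of the column (b,
  d) and the row (d, -b), so it depends only on the second column of the conjugating matrix.\<close>

lemma conj_class_lower:
  "conj_class_SL2 (mat2 1 0 t 1) =
    {mat2 (1 + t * b * d) (- t * b\<^sup>2) (t * d\<^sup>2) (1 - t * b * d) | a b c d.
      a * d - b * c = (1::'a::field)}"
proof -
  have *: "mat2 a b c d ** mat2 1 0 t 1 ** matrix_inv (mat2 a b c d) =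
      mat2 (1 + t * b * d) (- t * b\<^sup>2) (t * d\<^sup>2) (1 - t * b * d)"
    if "a * d - b * c = 1" for a b c d :: 'a
  proof -
    have "a * d = 1 + b * c" using that by (simp add: algebra_simps)
    then show ?thesis
      using that by (simp add: matrix_inv_mat2 mat2_mult mat2_eq_iff power2_eq_square algebra_simps)
  qed
  show ?thesis
    unfolding conj_class_SL2_def
  proof safe
    fix g :: "'a ^ 2 ^ 2" assume "g \<in> SL2"
    then show "\<exists>a b c d. g ** mat2 1 0 t 1 ** matrix_inv g =
        mat2 (1 + t * b * d) (- t * b\<^sup>2) (t * d\<^sup>2) (1 - t * b * d) \<and> a * d - b * c = 1"
      by (cases g rule: mat2_cases) (metis * mat2_mem_SL2)
  next
    fix a b c d :: 'a assume "a * d - b * c = 1"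
    then show "\<exists>g. mat2 (1 + t * b * d) (- t * b\<^sup>2) (t * d\<^sup>2) (1 - t * b * d) =
        g ** mat2 1 0 t 1 ** matrix_inv g \<and> g \<in> SL2"
      by (metis * mat2_mem_SL2)
  qed
qed

lemma conj_classes_eq_unip:
  assumes "CARD('a::{finite,field}) mod 4 = 3"
  shows "conj_class_SL2 (mat2 1 0 1 1) \<union> conj_class_SL2 (mat2 1 0 (-1) 1) = (unip :: ('a ^ 2 ^ 2) set)"
    (is "?C 1 \<union> ?C (-1) = _")
proof
  have "?C t \<subseteq> unip" if "t \<noteq> 0" for t
    unfolding conj_class_lower
    using that by (auto simp: mat2_mem_unip mat2_eq_iff power2_eq_square algebra_simps)
  then show "?C 1 \<union> ?C (-1) \<subseteq> unip" by simp
next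
  have mem: "mat2 (1 + t * b * d) (- t * b\<^sup>2) (t * d\<^sup>2) (1 - t * b * d) \<in> ?C t"
    if "a * d - b * c = 1" for t a b c d :: 'a
    unfolding conj_class_lower using that by blast
  show "unip \<subseteq> ?C 1 \<union> ?C (-1)"
  proof
    fix s :: "'a ^ 2 ^ 2" assume "s \<in> unip"
    obtain x y z x' where s0: "s = mat2 x y z x'" by (rule mat2_cases)
    define m where "m = x - 1"
    have "x' = 1 - m" "x = 1 + m"
      using \<open>s \<in> unip\<close> by (auto simp: s0 mat2_mem_unip m_def algebra_simps)
    with s0 have s: "s = mat2 (1 + m) y z (1 - m)" by simp
    have yz: "y * z = - m\<^sup>2" and nz: "\<not> (m = 0 \<and> y = 0 \<and> z = 0)"
      using \<open>s \<in> unip\<close>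
      by (auto simp: s mat2_mem_unip power2_eq_square algebra_simps eq_neg_iff_add_eq_0)
    show "s \<in> ?C 1 \<union> ?C (-1)"
    proof (cases "z = 0")
      case True
      then have m: "m = 0" using yz by simp
      then have "y \<noteq> 0" using nz True by simp
      obtain b where b: "y = b\<^sup>2 \<or> y = - b\<^sup>2" using square_or_neg_square[OF assms] .
      \<comment> \<open>Lower left entry 0 forces the column (b, 0); the first column (0, -1 / b)
        completes it to determinant 1. The upper right entry is then \<open>- t * b\<^sup>2\<close>,
        so the sign \<open>t\<close> is opposite to that in \<open>b\<close>.\<close>
      with \<open>y \<noteq> 0\<close> have "0 * 0 - b * (- 1 / b) = 1" by auto
      then show ?thesis
        using mem[of 0 0 b "- 1 / b" 1] mem[of 0 0 b "- 1 / b" "-1"] b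
        by (auto simp: s m True)
    next
      case False
      obtain d where d: "z = d\<^sup>2 \<or> z = - d\<^sup>2" using square_or_neg_square[OF assms] .
      with False have d0: "d \<noteq> 0" by auto
      have y: "y = - m\<^sup>2 / z" using yz False by (simp add: field_simps)
      \<comment> \<open>Here z = t d^2 with \<open>t\<close> equal to 1 or -1. The diagonal requires
        t b d = m, hence b = t m / d, and the first column (1 / d, 0) gives determinant 1.\<close>
      from d d0 show ?thesis
        using mem[of "1 / d" d "m / d" 0 1] mem[of "1 / d" d "- m / d" 0 "-1"]
        by (auto simp: s y power_divide)
    qed
  qed
qed


section \<open>Summation over the nontrivial unipotents\<close>

lemma unip_conj:
  assumes "g \<in> SL2" "s \<in> unip"
  shows "g ** s ** matrix_inv g \<in> unip"
proof -
  have "trace (g ** s ** matrix_inv g) = trace s"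
    by (metis SL2_cancel(2) assms(1) matrix_mul_assoc trace_mul_sym)
  moreover have "s = mat 1" if "g ** s ** matrix_inv g = mat 1"
    by (metis SL2_inv(2,3) SL2_cancel(2) assms(1) matrix_mul_assoc matrix_mul_rid that)
  ultimately show ?thesis
    using assms by (auto simp: unip_def SL2_mult SL2_inv)
qed

lemma sum_unip_conj:
  fixes h :: "'a::{finite,field} ^ 2 ^ 2 \<Rightarrow> real"
  assumes "g \<in> SL2"
  shows "(\<Sum>s\<in>unip. h (g ** s ** matrix_inv g)) = (\<Sum>s\<in>unip. h s)"
proof (rule sum.reindex_bij_witness[of _ "\<lambda>s. matrix_inv g ** s ** g" "\<lambda>s. g ** s ** matrix_inv g"])
  fix s :: "'a ^ 2 ^ 2" assume "s \<in> unip"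
  show "matrix_inv g ** s ** g \<in> unip"
    using unip_conj[of "matrix_inv g" s] \<open>s \<in> unip\<close> assms by (simp add: SL2_inv)
  show "matrix_inv g ** (g ** s ** matrix_inv g) ** g = s"
    using assms by (metis SL2_cancel(2) SL2_inv(3) matrix_mul_assoc matrix_mul_rid)
  show "g ** (matrix_inv g ** s ** g) ** matrix_inv g = s"
    using assms by (metis SL2_cancel(1) SL2_inv(2) matrix_mul_assoc matrix_mul_rid)
qed (use assms in \<open>simp_all add: unip_conj\<close>)

lemma SL2_row_ex:
  fixes r :: "'a::field ^ 2"
  assumes "r \<noteq> 0"
  obtains g where "g \<in> SL2" "g $ 1 = r"
proof (cases "r $ 1 = 0")
  case True
  then have "r $ 2 \<noteq> 0" using assms by (simp add: vec_eq_iff forall_2)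
  then show ?thesis
    using True that[of "mat2 0 (r $ 2) (- 1 / r $ 2) 0"]
    by (simp add: mat2_mem_SL2 vec_eq_iff forall_2)
next
  case False
  then show ?thesis
    using that[of "mat2 (r $ 1) (r $ 2) 0 (1 / r $ 1)"]
    by (simp add: mat2_mem_SL2 vec_eq_iff forall_2)
qed

lemma SL2_row_nz:
  assumes "g \<in> SL2"
  shows "g $ 1 \<noteq> 0"
  using assms by (cases g rule: mat2_cases) (auto simp: mat2_mem_SL2 vec_eq_iff forall_2)

lemma row_mult: "(A ** B) $ 1 = A $ 1 v* B"
  by (simp add: vec_eq_iff matrix_matrix_mult_def vector_matrix_mult_def)

text \<open>If the first row is (a, b) with b nonzero, trace and determinant fix the second row
  uniquely. If b = 0, then a + d = 2 and a d = 1 force a = d = 1, and the lower left entry takes q -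
  1 nonzero values.\<close>

lemma sum_unip_first_row:
  fixes h :: "'a::{finite,field} ^ 2 \<Rightarrow> real"
  shows "(\<Sum>s\<in>unip. h (s $ 1)) =
    (\<Sum>r | r $ 2 \<noteq> 0. h r) + (real CARD('a) - 1) * h (axis 1 1)"
proof -
  have "(\<Sum>s | s \<in> unip \<and> s $ 1 $ 2 \<noteq> 0. h (s $ 1)) = (\<Sum>r | r $ 2 \<noteq> 0. h r)"
  proof (rule sum.reindex_bij_witness[of _
        "\<lambda>r. mat2 (r $ 1) (r $ 2) (- (r $ 1 - 1)\<^sup>2 / r $ 2) (2 - r $ 1)" "\<lambda>s. s $ 1"])
    fix s :: "'a ^ 2 ^ 2" assume s: "s \<in> {s. s \<in> unip \<and> s $ 1 $ 2 \<noteq> 0}"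
    obtain a b c d where [simp]: "s = mat2 a b c d" by (rule mat2_cases)
    have d: "d = 2 - a" and det: "a * d - b * c = 1" and "b \<noteq> 0"
      using s by (auto simp: mat2_mem_unip algebra_simps)
    have "b * c = - (a - 1)\<^sup>2"
      using det unfolding d by (simp add: power2_eq_square algebra_simps eq_neg_iff_add_eq_0)
    then have "d = 2 - a" "c = - (a - 1)\<^sup>2 / b"
      using \<open>b \<noteq> 0\<close> d by (metis, metis mult.commute nonzero_eq_divide_eq)
    then show "mat2 (s $ 1 $ 1) (s $ 1 $ 2) (- (s $ 1 $ 1 - 1)\<^sup>2 / s $ 1 $ 2) (2 - s $ 1 $ 1) = s"
      by simp
  qed (auto simp: mat2_mem_unip mat2_eq_iff vec_eq_iff forall_2 power2_eq_square field_simps)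
  moreover have "(\<Sum>s | s \<in> unip \<and> s $ 1 $ 2 = 0. h (s $ 1)) = (\<Sum>c\<in>UNIV - {0 :: 'a}. h (axis 1 1))"
  proof (rule sum.reindex_bij_witness[of _ "\<lambda>c. mat2 1 0 c 1" "\<lambda>s. s $ 2 $ 1"])
    fix s :: "'a ^ 2 ^ 2" assume s: "s \<in> {s. s \<in> unip \<and> s $ 1 $ 2 = 0}"
    obtain a b c d where [simp]: "s = mat2 a b c d" by (rule mat2_cases)
    have b: "b = 0" and d: "d = 2 - a" and ad: "a * d = 1" and ne: "mat2 a b c d \<noteq> mat2 1 0 0 1"
      using s by (auto simp: mat2_mem_unip algebra_simps)
    have "(a - 1)\<^sup>2 = 0" using ad unfolding d by (simp add: power2_eq_square algebra_simps)
    then have a: "a = 1" by simp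
    show "mat2 1 0 (s $ 2 $ 1) 1 = s" using a b d by simp
    show "s $ 2 $ 1 \<in> UNIV - {0}" using ne a b d by (simp add: mat2_eq_iff)
    show "h (axis 1 1) = h (s $ 1)"
      by (rule arg_cong[of _ _ h]) (simp add: a b vec_eq_iff forall_2 axis_def)
  qed (auto simp: mat2_mem_unip mat2_eq_iff)
  moreover have "(\<Sum>s\<in>unip. h (s $ 1)) =
      (\<Sum>s | s \<in> unip \<and> s $ 1 $ 2 \<noteq> 0. h (s $ 1)) + (\<Sum>s | s \<in> unip \<and> s $ 1 $ 2 = 0. h (s $ 1))"
    by (subst sum.union_disjoint[symmetric]) (auto intro!: sum.cong)
  ultimately show ?thesis by (simp add: card_Diff_singleton of_nat_diff)
qed

text \<open>For \<open>g\<close> in \<open>SL2\<close> with first row \<open>r\<close>, the vector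
  \<open>r v* s\<close> is the first row of \<open>g ** s ** matrix_inv g\<close>, multiplied by
  \<open>g\<close>. As conjugation permutes \<open>unip\<close>, the count reduces to
  \<open>r = axis 1 1\<close>: \<open>r\<close> itself is reached q - 1 times and each vector off
  its line once.\<close>

lemma sum_unip_row:
  fixes h :: "'a::{finite,field} ^ 2 \<Rightarrow> real"
  assumes "r \<noteq> 0"
  shows "(\<Sum>s\<in>unip. h (r v* s)) =
    (real CARD('a) - 1) * h r + (\<Sum>z\<in>UNIV. h z) - (\<Sum>c\<in>UNIV. h (c *s r))"
proof -
  obtain g where g: "g \<in> SL2" "g $ 1 = r" using SL2_row_ex assms by blast
  have bij: "bij (\<lambda>z. z v* g)"
    by (rule bij_betw_byWitness[of _ "\<lambda>z. z v* matrix_inv g"])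
      (simp_all add: vector_matrix_mul_assoc SL2_inv g)
  have e1: "axis 1 1 v* g = r"
    by (simp add: g(2)[symmetric] vec_eq_iff forall_2 vector_matrix_mult_def sum_2 axis_def)
  have "(\<Sum>s\<in>unip. h (r v* s)) = (\<Sum>s\<in>unip. h ((g ** s ** matrix_inv g) $ 1 v* g))"
    by (simp add: row_mult[symmetric] g matrix_mul_assoc[symmetric] SL2_inv
        flip: g(2) cong: sum.cong)
  also have "\<dots> = (\<Sum>s\<in>unip. h (s $ 1 v* g))"
    by (rule sum_unip_conj[OF g(1), of "\<lambda>s. h (s $ 1 v* g)"])
  also have "\<dots> = (\<Sum>z | z $ 2 \<noteq> 0. h (z v* g)) + (real CARD('a) - 1) * h r"
    by (simp add: sum_unip_first_row[of "\<lambda>z. h (z v* g)"] e1)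
  also have "(\<Sum>z | z $ 2 \<noteq> 0. h (z v* g)) =
      (\<Sum>z\<in>UNIV. h (z v* g)) - (\<Sum>z | z $ 2 = 0. h (z v* g))"
    by (subst sum_diff[symmetric]) (auto intro!: sum.cong)
  also have "(\<Sum>z\<in>UNIV. h (z v* g)) = (\<Sum>z\<in>UNIV. h z)"
    using sum.reindex_bij_betw[OF bij] .
  also have "(\<Sum>z | z $ 2 = 0. h (z v* g)) = (\<Sum>c\<in>UNIV. h (c *s r))"
    by (rule sum.reindex_bij_witness[of _ "\<lambda>c. c *s axis 1 1" "\<lambda>z. z $ 1"])
      (auto simp: vec_eq_iff forall_2 axis_def vector_matrix_mult_def sum_2 simp flip: g(2)
        intro!: arg_cong[of _ _ h])
  finally show ?thesis by simp
qed

text \<open>The nontrivial unipotents are partitioned by the row line they fix, spanned by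
  \<open>(1, b)\<close> or \<open>(0, 1)\<close>.\<close>

lemma sum_unip_subgroups:
  fixes h :: "'a::{finite,field} ^ 2 ^ 2 \<Rightarrow> real"
  shows "(\<Sum>s\<in>unip. h s) =
    (\<Sum>b\<in>UNIV. \<Sum>t\<in>UNIV-{0}. h (mat2 (1 - t * b) (- t * b\<^sup>2) t (1 + t * b)))
    + (\<Sum>t\<in>UNIV-{0}. h (mat2 1 (- t) 0 1))"
proof -
  have "(\<Sum>s | s \<in> unip \<and> s $ 2 $ 1 \<noteq> 0. h s) =
      (\<Sum>(b, t)\<in>UNIV \<times> (UNIV-{0}). h (mat2 (1 - t * b) (- t * b\<^sup>2) t (1 + t * b)))"
  proof (rule sum.reindex_bij_witness[of _
        "\<lambda>(b, t). mat2 (1 - t * b) (- t * b\<^sup>2) t (1 + t * b)"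
        "\<lambda>s. ((s $ 2 $ 2 - 1) / s $ 2 $ 1, s $ 2 $ 1)"])
    fix s :: "'a ^ 2 ^ 2" assume s: "s \<in> {s. s \<in> unip \<and> s $ 2 $ 1 \<noteq> 0}"
    obtain a b c d where [simp]: "s = mat2 a b c d" by (rule mat2_cases)
    have a: "a = 2 - d" and det: "a * d - b * c = 1" and c: "c \<noteq> 0"
      using s by (auto simp: mat2_mem_unip algebra_simps)
    have "b * c = - (d - 1)\<^sup>2"
      using det unfolding a by (simp add: power2_eq_square algebra_simps eq_neg_iff_add_eq_0)
    then have b: "b = - (d - 1)\<^sup>2 / c"
      using c by (metis nonzero_eq_divide_eq)
    show *: "(case ((s $ 2 $ 2 - 1) / s $ 2 $ 1, s $ 2 $ 1) of
        (b, t) \<Rightarrow> mat2 (1 - t * b) (- t * b\<^sup>2) t (1 + t * b)) = s"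
      using c by (simp add: a b mat2_eq_iff power2_eq_square)
    show "(case ((s $ 2 $ 2 - 1) / s $ 2 $ 1, s $ 2 $ 1) of
        (b, t) \<Rightarrow> h (mat2 (1 - t * b) (- t * b\<^sup>2) t (1 + t * b))) = h s"
      using * by (simp del: \<open>s = mat2 a b c d\<close>)
  qed (auto simp: mat2_mem_unip mat2_eq_iff power2_eq_square algebra_simps)
  moreover have "(\<Sum>s | s \<in> unip \<and> s $ 2 $ 1 = 0. h s) = (\<Sum>t\<in>UNIV-{0}. h (mat2 1 (- t) 0 1))"
  proof (rule sum.reindex_bij_witness[of _ "\<lambda>t. mat2 1 (- t) 0 1" "\<lambda>s. - s $ 1 $ 2"])
    fix s :: "'a ^ 2 ^ 2" assume s: "s \<in> {s. s \<in> unip \<and> s $ 2 $ 1 = 0}"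
    obtain a b c d where [simp]: "s = mat2 a b c d" by (rule mat2_cases)
    have c: "c = 0" and d: "d = 2 - a" and ad: "a * d = 1" and ne: "mat2 a b c d \<noteq> mat2 1 0 0 1"
      using s by (auto simp: mat2_mem_unip algebra_simps)
    have "(a - 1)\<^sup>2 = 0" using ad unfolding d by (simp add: power2_eq_square algebra_simps)
    then have a: "a = 1" by simp
    show "mat2 1 (- (- s $ 1 $ 2)) 0 1 = s" using a c d by simp
    then show "h (mat2 1 (- (- s $ 1 $ 2)) 0 1) = h s" by (rule arg_cong)
    show "- s $ 1 $ 2 \<in> UNIV - {0}" using ne a c d by (simp add: mat2_eq_iff)
  qed (auto simp: mat2_mem_unip mat2_eq_iff)
  moreover have "(\<Sum>s\<in>unip. h s) =
      (\<Sum>s | s \<in> unip \<and> s $ 2 $ 1 \<noteq> 0. h s) + (\<Sum>s | s \<in> unip \<and> s $ 2 $ 1 = 0. h s)"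
    by (subst sum.union_disjoint[symmetric]) (auto intro!: sum.cong)
  ultimately show ?thesis by (simp add: sum.cartesian_product)
qed

lemma card_unip: "real (card (unip :: ('a::{finite,field} ^ 2 ^ 2) set)) = (real CARD('a))\<^sup>2 - 1"
proof -
  have "(\<Sum>s\<in>(unip :: ('a ^ 2 ^ 2) set). 1 :: real) = (real CARD('a))\<^sup>2 - 1"
    unfolding sum_unip_subgroups
    by (simp add: card_Diff_singleton of_nat_diff power2_eq_square algebra_simps)
  then show ?thesis by simp
qed

section \<open>The eigenvalue equation on the plane\<close>

lemma plane_eigenvalue:
  fixes F :: "'a::{finite,field} ^ 2 \<Rightarrow> real"
  assumes F0: "F 0 = 0" and nz: "F r0 \<noteq> 0"
    and eig: "\<And>r. r \<noteq> 0 \<Longrightarrow>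
      (real CARD('a) - 1) * F r + (\<Sum>z\<in>UNIV. F z) - (\<Sum>c\<in>UNIV. F (c *s r)) = \<nu> * F r"
  shows "\<nu> \<in> {(real CARD('a))\<^sup>2 - 1, real CARD('a) - 1, 0}"
proof -
  define q T where "q = real CARD('a)" and "T = (\<Sum>z\<in>UNIV. F z)"
  have T': "(\<Sum>z\<in>UNIV-{0}. F z) = T"
    unfolding T_def by (subst sum.remove[of _ 0]) (simp_all add: F0)
  have card0: "real (card (UNIV - {0 :: 'a ^ 2})) = q\<^sup>2 - 1"
    by (simp add: card_Diff_singleton of_nat_diff CARD_vec q_def card_ge_0_finite)
  have scale: "(\<Sum>r\<in>UNIV-{0}. F (c *s r)) = (if c = 0 then 0 else T)" for c
  proof (cases "c = 0")
    case False
    have "(\<Sum>r\<in>UNIV-{0}. F (c *s r)) = (\<Sum>z\<in>UNIV-{0}. F z)"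
      by (rule sum.reindex_bij_witness[of _ "\<lambda>z. (1 / c) *s z" "\<lambda>z. c *s z"])
        (use False in \<open>auto simp: vector_smult_assoc\<close>)
    with False T' show ?thesis by simp
  qed (simp add: F0)
  have "(\<Sum>r\<in>UNIV-{0}. \<Sum>c\<in>UNIV. F (c *s r)) = (\<Sum>c\<in>(UNIV :: 'a set). if c = 0 then 0 else T)"
    by (subst sum.swap) (simp add: scale)
  also have "\<dots> = (q - 1) * T"
    by (simp add: sum.remove[of _ 0] card_Diff_singleton of_nat_diff q_def)
  finally have scale': "(\<Sum>r\<in>UNIV-{0}. \<Sum>c\<in>UNIV. F (c *s r)) = (q - 1) * T" .
  \<comment> \<open>Each nonzero scalar permutes the nonzero vectors, so the line sums total (q - 1)
    T and cancel the diagonal term.\<close>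
  have "\<nu> * T = (\<Sum>r\<in>UNIV-{0}. \<nu> * F r)"
    by (simp add: T' flip: sum_distrib_left)
  also have "\<dots> = (\<Sum>r\<in>UNIV-{0}. (q - 1) * F r + T - (\<Sum>c\<in>UNIV. F (c *s r)))"
    using eig by (intro sum.cong) (auto simp: q_def T_def)
  also have "\<dots> = (q - 1) * T + (q\<^sup>2 - 1) * T - (q - 1) * T"
    by (simp add: sum.distrib sum_subtractf T' scale' card0[unfolded q_def] q_def flip: sum_distrib_left)
  finally have 1: "\<nu> = q\<^sup>2 - 1 \<or> T = 0" by auto
  show ?thesis
  proof (cases "T = 0")
    case False
    with 1 show ?thesis by (simp add: q_def)
  next
    case True
    define R where "R r = (\<Sum>c\<in>UNIV. F (c *s r))" for r
    have eig': "\<nu> * F r = (q - 1) * F r - R r" if "r \<noteq> 0" for r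
      using eig[OF that] True by (simp add: q_def T_def R_def)
    have R_scale: "R (c *s r) = R r" if "c \<noteq> 0" for c r
      unfolding R_def
      by (rule sum.reindex_bij_witness[of _ "\<lambda>d. d / c" "\<lambda>d. d * c"])
        (use that in \<open>auto simp: vector_smult_assoc\<close>)
    have R': "R r = (\<Sum>c\<in>UNIV-{0}. F (c *s r))" for r
      unfolding R_def by (subst sum.remove[of _ 0]) (simp_all add: F0)
    \<comment> \<open>\<open>R\<close> is constant on the q - 1 nonzero multiples of
      \<open>r\<close>, so summing \<open>eig'\<close> over them makes the two terms cancel. For
      nonzero \<open>\<nu>\<close> this gives R r0 = 0, and \<open>eig'\<close> at \<open>r0\<close>
      then yields q - 1.\<close>
    have R0: "\<nu> * R r = 0" if "r \<noteq> 0" for r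
    proof -
      have "\<nu> * R r = (\<Sum>c\<in>UNIV-{0}. (q - 1) * F (c *s r) - R r)"
        unfolding R'[of r] sum_distrib_left
        by (intro sum.cong) (use that in \<open>auto simp: eig' R_scale simp flip: R'\<close>)
      also have "\<dots> = (q - 1) * R r - (q - 1) * R r"
        by (simp add: sum_subtractf card_Diff_singleton of_nat_diff q_def R' flip: sum_distrib_left)
      finally show ?thesis by simp
    qed
    have "r0 \<noteq> 0" using nz F0 by auto
    with eig' R0[of r0] nz show ?thesis by (fastforce simp: q_def)
  qed
qed


section \<open>The spectrum of the Cayley graph\<close>

text \<open>Left translation by \<open>h\<close> commutes with the right multiplications in the
  operator, and right multiplication by \<open>s\<close> carries the matrices with first row
  \<open>r\<close> bijectively to those with first row \<open>r v* s\<close>.\<close>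

lemma row_sum_eigen:
  fixes f :: "'a::{finite,field} ^ 2 ^ 2 \<Rightarrow> real"
  assumes eig: "\<And>x. x \<in> SL2 \<Longrightarrow> (\<Sum>s\<in>unip. f (x ** s)) = \<nu> * f x" and h: "h \<in> SL2"
  defines "F \<equiv> \<lambda>r. \<Sum>g | g \<in> SL2 \<and> g $ 1 = r. f (h ** g)"
  shows "(\<Sum>s\<in>unip. F (r v* s)) = \<nu> * F r"
proof -
  have "F (r v* s) = (\<Sum>g | g \<in> SL2 \<and> g $ 1 = r. f (h ** g ** s))" if "s \<in> unip" for s
  proof -
    have s: "s \<in> SL2" using that by (simp add: unip_def)
    show ?thesis
      unfolding F_def
      by (rule sum.reindex_bij_witness[of _ "\<lambda>g. g ** s" "\<lambda>g. g ** matrix_inv s"])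
        (auto simp: s SL2_mult SL2_inv row_mult vector_matrix_mul_assoc
          simp flip: matrix_mul_assoc)
  qed
  then have "(\<Sum>s\<in>unip. F (r v* s)) = (\<Sum>g | g \<in> SL2 \<and> g $ 1 = r. \<Sum>s\<in>unip. f (h ** g ** s))"
    by (subst sum.swap) simp
  also have "\<dots> = \<nu> * F r"
    unfolding F_def sum_distrib_left by (intro sum.cong) (auto simp: eig SL2_mult h)
  finally show ?thesis .
qed

text \<open>The quotient fixes the row (1, 0), and determinant 1 makes its other diagonal entry 1.
  Thus matrices in \<open>SL2\<close> sharing a first row form a coset of the lower unitriangular
  group.\<close>

lemma SL2_same_row:
  assumes "g \<in> SL2" "y \<in> SL2" "g $ 1 = y $ 1"
  shows "mat2 1 0 ((g ** matrix_inv y) $ 2 $ 1) 1 = g ** matrix_inv y"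
proof -
  obtain a b c d where k: "g ** matrix_inv y = mat2 a b c d" by (rule mat2_cases)
  have "(g ** matrix_inv y) $ 1 = (mat 1 :: 'a ^ 2 ^ 2) $ 1"
    using assms by (metis SL2_inv(2) row_mult)
  then have "a = 1" "b = 0" by (simp_all add: k mat_1_mat2 vec_eq_iff forall_2)
  moreover have "mat2 a b c d \<in> SL2" using assms by (simp flip: k add: SL2_mult SL2_inv)
  ultimately show ?thesis by (simp add: k mat2_mem_SL2)
qed

text \<open>Translating by \<open>x ** matrix_inv y\<close> turns a row sum into a sum over the
  coset of a conjugate of the lower unitriangular group through \<open>x\<close>. Removing the
  identity from that subgroup leaves \<open>- f x\<close>, once for each of the q + 1
  subgroups.\<close>

lemma vanishing_row_sums:
  fixes f :: "'a::{finite,field} ^ 2 ^ 2 \<Rightarrow> real"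
  assumes vanish: "\<And>h r. h \<in> SL2 \<Longrightarrow> (\<Sum>g | g \<in> SL2 \<and> g $ 1 = r. f (h ** g)) = 0"
    and x: "x \<in> SL2"
  shows "(\<Sum>s\<in>unip. f (x ** s)) = - (real CARD('a) + 1) * f x"
proof -
  have *: "(\<Sum>t\<in>UNIV-{0}. f (x ** (matrix_inv y ** mat2 1 0 t 1 ** y))) = - f x"
    if y: "y \<in> SL2" for y
  proof -
    have "(\<Sum>t\<in>UNIV. f (x ** (matrix_inv y ** mat2 1 0 t 1 ** y))) =
        (\<Sum>g | g \<in> SL2 \<and> g $ 1 = y $ 1. f (x ** matrix_inv y ** g))"
    proof (rule sum.reindex_bij_witness[of _ "\<lambda>g. (g ** matrix_inv y) $ 2 $ 1" "\<lambda>t. mat2 1 0 t 1 ** y"])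
      fix t :: 'a
      have "(mat2 1 0 t 1 ** y) $ 1 = y $ 1"
        by (simp add: vec_eq_iff matrix_matrix_mult_def sum_2)
      then show "mat2 1 0 t 1 ** y \<in> {g. g \<in> SL2 \<and> g $ 1 = y $ 1}"
        using y by (simp add: SL2_mult mat2_mem_SL2)
    next
      fix g assume "g \<in> {g. g \<in> SL2 \<and> g $ 1 = y $ 1}"
      then show "mat2 1 0 ((g ** matrix_inv y) $ 2 $ 1) 1 ** y = g"
        using y by (simp add: SL2_same_row SL2_inv flip: matrix_mul_assoc)
    qed (simp_all add: y SL2_inv flip: matrix_mul_assoc)
    also have "\<dots> = 0" using vanish x y by (simp add: SL2_mult SL2_inv)
    finally show ?thesis
      by (simp add: sum.remove[of UNIV 0] y SL2_inv flip: mat_1_mat2)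
  qed
  \<comment> \<open>The matrices \<open>y\<close> are chosen with first rows (1, b) and, afterwards,
    (0, 1): one for each line of row vectors.\<close>
  have "(\<Sum>t\<in>UNIV-{0}. f (x ** mat2 (1 - t * b) (- t * b\<^sup>2) t (1 + t * b))) = - f x" for b
    using *[of "mat2 1 b 0 1"]
    by (simp add: mat2_mem_SL2 matrix_inv_mat2 mat2_mult power2_eq_square algebra_simps)
  moreover have "(\<Sum>t\<in>UNIV-{0}. f (x ** mat2 1 (- t) 0 1)) = - f x"
    using *[of "mat2 0 1 (-1) 0"] by (simp add: mat2_mem_SL2 matrix_inv_mat2 mat2_mult)
  ultimately show ?thesis
    unfolding sum_unip_subgroups by (simp add: algebra_simps)
qed

lemma cayley_eigenvalue:
  fixes f :: "'a::{finite,field} ^ 2 ^ 2 \<Rightarrow> real"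
  assumes eig: "\<And>x. x \<in> SL2 \<Longrightarrow> (\<Sum>s\<in>unip. f (x ** s)) = \<nu> * f x"
    and x0: "x0 \<in> SL2" "f x0 \<noteq> 0"
  shows "\<nu> \<in> {(real CARD('a))\<^sup>2 - 1, real CARD('a) - 1, 0, - (real CARD('a) + 1)}"
proof (cases "\<forall>h\<in>SL2. \<forall>r. (\<Sum>g | g \<in> SL2 \<and> g $ 1 = r. f (h ** g)) = 0")
  case True
  then have "(\<Sum>s\<in>unip. f (x0 ** s)) = - (real CARD('a) + 1) * f x0"
    using vanishing_row_sums x0 by blast
  then show ?thesis using eig[OF x0(1)] x0(2) by simp
next
  case False
  then obtain h r0 where h: "h \<in> SL2" and nz: "(\<Sum>g | g \<in> SL2 \<and> g $ 1 = r0. f (h ** g)) \<noteq> 0"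
    by blast
  define F where "F r = (\<Sum>g | g \<in> SL2 \<and> g $ 1 = r. f (h ** g))" for r
  have "{g. g \<in> SL2 \<and> g $ 1 = (0 :: 'a ^ 2)} = {}" using SL2_row_nz by blast
  then have "F 0 = 0" by (simp only: F_def sum.empty)
  moreover have "(\<Sum>s\<in>unip. F (r v* s)) = \<nu> * F r" for r
    unfolding F_def by (rule row_sum_eigen[OF eig h])
  moreover have "F r0 \<noteq> 0" using nz by (simp add: F_def)
  ultimately have "\<nu> \<in> {(real CARD('a))\<^sup>2 - 1, real CARD('a) - 1, 0}"
    by (intro plane_eigenvalue[of F r0]) (simp_all flip: sum_unip_row)
  then show ?thesis by auto
qed

section \<open>Transfer to the twisted graphs\<close>

lemma sum_adj_of:
  fixes v :: "'v \<Rightarrow> real"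
  assumes "finite V" "finite S" "\<And>s. s \<in> S \<Longrightarrow> f x s \<in> V"
  shows "(\<Sum>y\<in>V. real (adj_of S f x y) * v y) = (\<Sum>s\<in>S. v (f x s))"
proof -
  have "(\<Sum>s\<in>S. v (f x s)) = (\<Sum>y\<in>V. \<Sum>s | s \<in> S \<and> f x s = y. v (f x s))"
    using assms by (subst sum.group) auto
  also have "\<dots> = (\<Sum>y\<in>V. real (adj_of S f x y) * v y)"
    by (intro sum.cong) (simp_all add: adj_of_def)
  finally show ?thesis by simp
qed

lemma unip_inv:
  assumes "s \<in> unip"
  shows "matrix_inv s \<in> unip"
  using assms
  by (cases s rule: mat2_cases)
    (auto simp: mat2_mem_unip matrix_inv_mat2 mat2_eq_iff algebra_simps)

text \<open>The operators of all three graphs have the form \<open>v \<mapsto> (x \<mapsto> \<Sum>s. v (\<tau> x ** s))\<close> up to a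
  permutation \<open>\<psi>\<close> of the connection set; the hypothesis on \<open>\<phi>\<close> makes its square
  the square of the Cayley graph operator.\<close>

lemma ramanujan_twist:
  fixes \<tau> \<psi> :: "'a::{finite,field} ^ 2 ^ 2 \<Rightarrow> 'a ^ 2 ^ 2"
  assumes card: "CARD('a) \<ge> 3"
    and \<tau>: "\<And>x. x \<in> SL2 \<Longrightarrow> \<tau> x \<in> SL2"
    and \<phi>: "\<And>x. x \<in> SL2 \<Longrightarrow> bij_betw (\<phi> x) unip unip"
      "\<And>x s. x \<in> SL2 \<Longrightarrow> s \<in> unip \<Longrightarrow> \<tau> (\<tau> x ** s) = x ** \<phi> x s"
    and \<psi>: "bij_betw \<psi> unip unip"
    and f: "\<And>x s. x \<in> SL2 \<Longrightarrow> s \<in> unip \<Longrightarrow> f x s = \<tau> x ** \<psi> s"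
  shows "ramanujan SL2 (adj_of unip f) (card (unip :: ('a ^ 2 ^ 2) set))"
proof -
  let ?k = "card (unip :: ('a ^ 2 ^ 2) set)"
  define q where "q = real CARD('a)"
  have q: "q \<ge> 3" using card by (simp add: q_def)
  have k: "real ?k = q\<^sup>2 - 1" by (simp add: q_def card_unip)
  have unip_SL2: "s \<in> SL2" if "s \<in> unip" for s :: "'a ^ 2 ^ 2"
    using that by (simp add: unip_def)
  have \<psi>_mem: "\<psi> s \<in> unip" if "s \<in> unip" for s
    using \<psi> that bij_betwE by blast
  have f_mem: "f x s \<in> SL2" if "x \<in> SL2" "s \<in> unip" for x s
    using that by (simp add: f \<tau> SL2_mult unip_SL2 \<psi>_mem)
  have op: "(\<Sum>y\<in>SL2. real (adj_of unip f x y) * v y) = (\<Sum>s\<in>unip. v (\<tau> x ** s))"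
    if "x \<in> SL2" for x and v :: "'a ^ 2 ^ 2 \<Rightarrow> real"
  proof -
    have "(\<Sum>y\<in>SL2. real (adj_of unip f x y) * v y) = (\<Sum>s\<in>unip. v (f x s))"
      by (rule sum_adj_of) (use that f_mem in auto)
    also have "\<dots> = (\<Sum>s\<in>unip. v (\<tau> x ** \<psi> s))"
      using that by (simp add: f)
    also have "\<dots> = (\<Sum>s\<in>unip. v (\<tau> x ** s))"
      by (rule sum.reindex_bij_betw[OF \<psi>])
    finally show ?thesis .
  qed
  have adj: "adj_of unip f x y = (if \<exists>s\<in>unip. y = \<tau> x ** s then 1 else 0)"
    if x: "x \<in> SL2" and y: "y \<in> SL2" for x y
  proof -
    \<comment> \<open>Applying \<open>op\<close> to the indicator function of \<open>y\<close>
      isolates one matrix entry. Since left multiplication by \<open>\<tau> x\<close> is injective,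
      at most one \<open>s\<close> contributes.\<close>
    have "real (adj_of unip f x y) = (\<Sum>z\<in>SL2. real (adj_of unip f x z) * (if z = y then 1 else 0))"
      using y by (simp add: if_distrib sum.delta' cong: if_cong)
    also have "\<dots> = (\<Sum>s\<in>unip. if \<tau> x ** s = y then 1 else 0)"
      by (rule op[OF x])
    also have "\<dots> = (\<Sum>s\<in>unip. if s = matrix_inv (\<tau> x) ** y then 1 else 0)"
      by (intro sum.cong) (auto simp: SL2_cancel \<tau> x)
    also have "\<dots> = (if \<exists>s\<in>unip. y = \<tau> x ** s then 1 else 0)"
      using \<tau>[OF x] by (auto simp: SL2_cancel intro: bexI[of _ "matrix_inv (\<tau> x) ** y"])
    finally show ?thesis by (simp split: if_splits)
  qed
  \<comment> \<open>An edge from \<open>x\<close> given by \<open>s\<close> is reversed by the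
    inverse of \<open>\<phi> x s\<close>, because \<open>\<tau> y = x ** \<phi> x s\<close>.\<close>
  have sym: "\<exists>s\<in>unip. x = \<tau> y ** s" if x: "x \<in> SL2" and edge: "\<exists>s\<in>unip. y = \<tau> x ** s" for x y
  proof -
    obtain s where s: "s \<in> unip" "y = \<tau> x ** s" using edge by blast
    have m: "\<phi> x s \<in> unip" using \<phi>(1)[OF x] s bij_betwE by blast
    have "\<tau> y = x ** \<phi> x s" using \<phi>(2) x s by simp
    then have "x = \<tau> y ** matrix_inv (\<phi> x s)"
      using m by (simp add: unip_SL2 SL2_inv flip: matrix_mul_assoc)
    with unip_inv[OF m] show ?thesis by blast
  qed
  have eigen: "\<bar>\<mu>\<bar> \<le> 2 * sqrt (real ?k - 1)"
    if x0: "x0 \<in> SL2" "v x0 \<noteq> 0" and \<mu>: "\<bar>\<mu>\<bar> \<noteq> real ?k"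
      and eig: "\<And>x. x \<in> SL2 \<Longrightarrow> (\<Sum>y\<in>SL2. real (adj_of unip f x y) * v y) = \<mu> * v x"
    for \<mu> v x0
  proof -
    have B: "(\<Sum>s\<in>unip. v (\<tau> x ** s)) = \<mu> * v x" if "x \<in> SL2" for x
      using eig[OF that] op[OF that] by simp
    define A where "A w x = (\<Sum>s\<in>unip. w (x ** s))" for w :: "'a ^ 2 ^ 2 \<Rightarrow> real" and x
    have A2: "A (A v) x = \<mu>\<^sup>2 * v x" if x: "x \<in> SL2" for x
    proof -
      have "A (A v) x = (\<Sum>s\<in>unip. \<Sum>t\<in>unip. v (x ** \<phi> x s ** t))"
        unfolding A_def by (rule sum.reindex_bij_betw[OF \<phi>(1)[OF x], symmetric])
      also have "\<dots> = (\<Sum>s\<in>unip. \<Sum>t\<in>unip. v (\<tau> (\<tau> x ** s) ** t))"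
        by (simp add: \<phi>(2) x)
      also have "\<dots> = (\<Sum>s\<in>unip. \<mu> * v (\<tau> x ** s))"
        by (intro sum.cong refl B SL2_mult \<tau> x unip_SL2)
      also have "\<dots> = \<mu>\<^sup>2 * v x"
        by (simp add: B x power2_eq_square flip: sum_distrib_left)
      finally show ?thesis .
    qed
    \<comment> \<open>By \<open>A2\<close>, (A - mu)(A + mu) v = 0 on \<open>SL2\<close>. Either (A
      + mu) v vanishes there and \<open>v\<close> has eigenvalue -mu, or (A + mu) v is itself an
      eigenfunction for mu.\<close>
    have "\<exists>\<nu> w x1. \<bar>\<nu>\<bar> = \<bar>\<mu>\<bar> \<and> x1 \<in> SL2 \<and> w x1 \<noteq> 0 \<and> (\<forall>x\<in>SL2. A w x = \<nu> * w x)"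
    proof (cases "\<forall>x\<in>SL2. A v x + \<mu> * v x = 0")
      case True
      then have "\<forall>x\<in>SL2. A v x = (- \<mu>) * v x" by (simp add: add_eq_0_iff)
      then show ?thesis using x0 by (intro exI[of _ "- \<mu>"] exI[of _ v] exI[of _ x0]) simp
    next
      case False
      then obtain x1 where "x1 \<in> SL2" "A v x1 + \<mu> * v x1 \<noteq> 0" by blast
      moreover have "A (\<lambda>x. A v x + \<mu> * v x) x = \<mu> * (A v x + \<mu> * v x)" if "x \<in> SL2" for x
        using A2[OF that] unfolding A_def
        by (simp add: sum.distrib power2_eq_square algebra_simps flip: sum_distrib_left)
      ultimately show ?thesis
        by (intro exI[of _ \<mu>] exI[of _ "\<lambda>x. A v x + \<mu> * v x"] exI[of _ x1]) simp
    qed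
    then obtain \<nu> w x1 where \<nu>: "\<bar>\<nu>\<bar> = \<bar>\<mu>\<bar>" and w: "x1 \<in> SL2" "w x1 \<noteq> 0"
      and eigA: "\<And>x. x \<in> SL2 \<Longrightarrow> A w x = \<nu> * w x" by blast
    have "\<nu> \<in> {q\<^sup>2 - 1, q - 1, 0, - (q + 1)}"
      unfolding q_def by (rule cayley_eigenvalue[OF eigA[unfolded A_def] w])
    moreover have "\<bar>\<nu>\<bar> \<noteq> q\<^sup>2 - 1" using \<mu> \<nu> k by simp
    ultimately have "\<bar>\<mu>\<bar> \<le> q + 1" using q unfolding \<nu>[symmetric] by auto
    also have "q + 1 \<le> 2 * sqrt (q\<^sup>2 - 2)"
    proof -
      \<comment> \<open>The difference 4 (q^2 - 2) - (q + 1)^2 equals (q - 3)(3 q + 7) + 12.\<close>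
      have "0 \<le> (q - 3) * (3 * q + 7)" using q by simp
      then have "(q + 1)\<^sup>2 \<le> 4 * (q\<^sup>2 - 2)" by (simp add: power2_eq_square algebra_simps)
      then have "q + 1 \<le> sqrt (4 * (q\<^sup>2 - 2))" by (rule real_le_rsqrt)
      then show ?thesis by (simp only: real_sqrt_mult real_sqrt_four)
    qed
    finally show ?thesis by (simp add: k)
  qed
  show ?thesis
    unfolding ramanujan_def
  proof (intro conjI ballI allI impI)
    fix x y :: "'a ^ 2 ^ 2" assume "x \<in> SL2" "y \<in> SL2"
    then show "adj_of unip f x y = adj_of unip f y x"
      using sym[of x y] sym[of y x] by (simp add: adj)
  next
    fix x :: "'a ^ 2 ^ 2" assume "x \<in> SL2"
    then show "(\<Sum>y\<in>SL2. adj_of unip f x y) = ?k"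
      using op[of x "\<lambda>_. 1"] by (simp flip: of_nat_sum)
  next
    fix \<mu> :: real
    assume "\<exists>v. (\<exists>x\<in>SL2. v x \<noteq> 0) \<and>
      (\<forall>x\<in>SL2. (\<Sum>y\<in>SL2. real (adj_of unip f x y) * v y) = \<mu> * v x)" and "\<bar>\<mu>\<bar> \<noteq> real ?k"
    then show "\<bar>\<mu>\<bar> \<le> 2 * sqrt (real ?k - 1)" using eigen by blast
  qed simp
qed

section \<open>The three graphs\<close>

theorem theorem5p3:
  fixes w :: "'a::{finite,field} ^ 2 ^ 2"
  assumes "CARD('a) mod 4 = 3"
    and "w = mat2 0 1 1 0 \<or> w = mat2 0 1 (-1) 0"
  defines "S \<equiv> conj_class_SL2 (mat2 1 0 1 1) \<union> conj_class_SL2 (mat2 1 0 (-1) 1)"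
    and "\<sigma> \<equiv> (\<lambda>x. w ** x ** matrix_inv w)"
  shows "ramanujan SL2 (C_Sigma_adj S) (card S)
       \<and> ramanujan SL2 (C_twist_adj \<sigma> S) (card S)
       \<and> ramanujan SL2 (C_Sigma_twist_adj \<sigma> S) (card S)"
proof -
  have S: "S = unip" unfolding S_def by (rule conj_classes_eq_unip[OF assms(1)])
  have card: "CARD('a) \<ge> 3" using assms(1) by presburger
  have unip_SL2: "s \<in> SL2" if "s \<in> unip" for s :: "'a ^ 2 ^ 2"
    using that by (simp add: unip_def)
  \<comment> \<open>The sign \<open>e\<close> treats both choices of \<open>w\<close> at once; since
    e^2 = 1, either conjugation is an involution.\<close>
  obtain e where e: "e = 1 \<or> e = - 1" and w: "w = mat2 0 1 e 0" using assms(2) by blast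
  have inv_w: "matrix_inv w = mat2 0 e 1 0"
    by (rule matrix_inv_unique) (use e in \<open>auto simp: w mat2_mult mat_1_mat2\<close>)
  have \<sigma>: "\<sigma> (mat2 a b c d) = mat2 d (e * c) (e * b) a" for a b c d
    using e by (auto simp: \<sigma>_def inv_w mat2_mult) (auto simp: w mat2_mult)
  have \<sigma>_mult: "\<sigma> (x ** y) = \<sigma> x ** \<sigma> y" for x y
    by (cases x rule: mat2_cases, cases y rule: mat2_cases)
      (use e in \<open>auto simp: \<sigma> mat2_mult mat2_eq_iff algebra_simps\<close>)
  have \<sigma>_\<sigma>: "\<sigma> (\<sigma> x) = x" for x
    by (cases x rule: mat2_cases) (use e in \<open>auto simp: \<sigma>\<close>)
  have \<sigma>_SL2: "\<sigma> x \<in> SL2" if "x \<in> SL2" for x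
    using that by (cases x rule: mat2_cases) (use e in \<open>auto simp: \<sigma> mat2_mem_SL2 algebra_simps\<close>)
  have \<sigma>_unip: "\<sigma> s \<in> unip" if "s \<in> unip" for s
    using that by (cases s rule: mat2_cases)
      (use e in \<open>auto simp: \<sigma> mat2_mem_unip mat2_eq_iff algebra_simps\<close>)
  have \<sigma>_inv: "\<sigma> (matrix_inv x) = matrix_inv (\<sigma> x)" if "x \<in> SL2" for x
  proof (rule matrix_inv_unique[symmetric])
    have "\<sigma> (mat 1) = mat 1" using e by (auto simp: mat_1_mat2 \<sigma>)
    then show "\<sigma> x ** \<sigma> (matrix_inv x) = mat 1" by (simp add: that SL2_inv flip: \<sigma>_mult)
  qed
  have bij_\<sigma>: "bij_betw \<sigma> unip unip"
    by (rule bij_betw_byWitness[of _ \<sigma>]) (auto simp: \<sigma>_\<sigma> \<sigma>_unip)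
  have bij_inv: "bij_betw matrix_inv (unip :: ('a ^ 2 ^ 2) set) unip"
    by (rule bij_betw_byWitness[of _ matrix_inv]) (auto simp: unip_inv unip_SL2 SL2_inv)
  have bij_conj: "bij_betw (\<lambda>s. matrix_inv x ** s ** x) unip unip"
    if x: "x \<in> SL2" for x :: "'a ^ 2 ^ 2"
  proof (rule bij_betw_byWitness[of _ "\<lambda>s. x ** s ** matrix_inv x"])
    show "(\<lambda>s. matrix_inv x ** s ** x) ` unip \<subseteq> unip"
      using unip_conj[of "matrix_inv x"] x by (auto simp: SL2_inv)
    show "(\<lambda>s. x ** s ** matrix_inv x) ` unip \<subseteq> unip"
      using unip_conj x by auto
  qed (auto simp: x SL2_inv SL2_cancel simp flip: matrix_mul_assoc)
  \<comment> \<open>Here \<open>\<phi>\<close> comes from (x^-1 s)^-1 = s^-1 x = x (x^-1 s^-1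
    x).\<close>
  have "ramanujan SL2 (adj_of unip (\<lambda>(x :: 'a ^ 2 ^ 2) s. matrix_inv x ** s)) (card (unip :: ('a ^ 2 ^ 2) set))"
  proof (rule ramanujan_twist[where \<tau> = matrix_inv and \<psi> = id
        and \<phi> = "\<lambda>x s. matrix_inv x ** matrix_inv s ** x"])
    fix x :: "'a ^ 2 ^ 2" assume "x \<in> SL2"
    then show "bij_betw (\<lambda>s. matrix_inv x ** matrix_inv s ** x) unip unip"
      using bij_betw_trans[OF bij_inv bij_conj] by (simp add: comp_def)
  qed (auto simp: card SL2_inv SL2_inv_mult SL2_cancel unip_SL2 simp flip: matrix_mul_assoc)
  moreover have "ramanujan SL2 (adj_of unip (\<lambda>x s. \<sigma> (x ** s))) (card (unip :: ('a ^ 2 ^ 2) set))"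
    by (rule ramanujan_twist[where \<tau> = \<sigma> and \<psi> = \<sigma> and \<phi> = "\<lambda>x. \<sigma>"])
      (auto simp: card \<sigma>_SL2 \<sigma>_mult \<sigma>_\<sigma> bij_\<sigma>)
  \<comment> \<open>Applying \<open>\<tau>\<close> to \<open>\<tau> x ** s\<close> gives sigma(s)^-1
    x, because \<open>\<sigma>\<close> is an involutive automorphism commuting with inversion;
    moving \<open>x\<close> to the left yields \<open>\<phi>\<close>.\<close>
  moreover have "ramanujan SL2 (adj_of unip (\<lambda>x s. \<sigma> (matrix_inv x ** s))) (card (unip :: ('a ^ 2 ^ 2) set))"
  proof (rule ramanujan_twist[where \<tau> = "\<lambda>x. \<sigma> (matrix_inv x)" and \<psi> = \<sigma>
        and \<phi> = "\<lambda>x s. matrix_inv x ** matrix_inv (\<sigma> s) ** x"])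
    fix x :: "'a ^ 2 ^ 2" assume "x \<in> SL2"
    then show "bij_betw (\<lambda>s. matrix_inv x ** matrix_inv (\<sigma> s) ** x) unip unip"
      using bij_betw_trans[OF bij_betw_trans[OF bij_\<sigma> bij_inv] bij_conj] by (simp add: comp_def)
  qed (auto simp: card \<sigma>_SL2 \<sigma>_mult \<sigma>_\<sigma> \<sigma>_inv bij_\<sigma> SL2_inv SL2_inv_mult SL2_mult SL2_cancel unip_SL2
      simp flip: matrix_mul_assoc)
  ultimately show ?thesis
    unfolding S C_Sigma_adj_def C_twist_adj_def C_Sigma_twist_adj_def by blast
qed

end
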